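(* Let a countable group $G$ act by isometries on a complete $\mathrm{CAT}(0)$ space $Y$. Assume that there exists $B<\infty$ such that $\mathrm{ord}(g)\le B$ for every $g\in G$. Then $l_\mu(G)=0$ for every finitely supported probability measure $\mu$ on $G$.
   Context: The drift of the action of $G$ on $Y$ with respect to $\mu$ is $$l_\mu(G)=\lim_{n\to\infty}\frac1n\int_G d(y,gy)\,d\mu^{*n}(g),$$ where $\mu^{*n}$ is the $n$-th convolution power of $\mu$ and $y\in Y$; the limit exists and does not depend on $y$. $\mathrm{ord}(g)$ denotes the order of $g$. *)

theory Defs
  imports
    "HOL-Probability.Probability_Mass_Function"
    "HOL-Algebra.Multiplicative_Group"
    "HOL-Algebra.Group_Action"
begin

section \<open>CAT(0) spaces\<close>

text \<open>A segment from x to y is the image of an isometric embedding of the interval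
  from 0 to d x y; the same set is then also a segment from y to x.\<close>

definition geodesic_segment :: "'a set \<Rightarrow> ('a \<Rightarrow> 'a \<Rightarrow> real) \<Rightarrow> 'a \<Rightarrow> 'a \<Rightarrow> 'a set \<Rightarrow> bool" where
  "geodesic_segment Y d x y S \<longleftrightarrow>
    (\<exists>c. c \<in> {0..d x y} \<rightarrow> Y \<and> c 0 = x \<and> c (d x y) = y \<and>
         (\<forall>s\<in>{0..d x y}. \<forall>t\<in>{0..d x y}. d (c s) (c t) = \<bar>s - t\<bar>) \<and>
         S = c ` {0..d x y})"

definition comparison_triangle ::
    "('a \<Rightarrow> 'a \<Rightarrow> real) \<Rightarrow> 'a \<Rightarrow> 'a \<Rightarrow> 'a \<Rightarrow> real^2 \<Rightarrow> real^2 \<Rightarrow> real^2 \<Rightarrow> bool" where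
  "comparison_triangle d x y z x' y' z' \<longleftrightarrow>
    dist x' y' = d x y \<and> dist y' z' = d y z \<and> dist z' x' = d z x"

text \<open>The point p' of the Euclidean segment from x' to y' corresponds to the point p of the
  segment S from x to y.\<close>

definition comparison_point ::
    "('a \<Rightarrow> 'a \<Rightarrow> real) \<Rightarrow> 'a \<Rightarrow> 'a set \<Rightarrow> real^2 \<Rightarrow> real^2 \<Rightarrow> 'a \<Rightarrow> real^2 \<Rightarrow> bool" where
  "comparison_point d x S x' y' p p' \<longleftrightarrow>
    p \<in> S \<and> p' \<in> closed_segment x' y' \<and> dist x' p' = d x p"

definition CAT0_space :: "'a set \<Rightarrow> ('a \<Rightarrow> 'a \<Rightarrow> real) \<Rightarrow> bool" where
  "CAT0_space Y d \<longleftrightarrow>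
    Metric_space Y d \<and>
    (\<forall>x\<in>Y. \<forall>y\<in>Y. \<exists>S. geodesic_segment Y d x y S) \<and>
    (\<forall>x\<in>Y. \<forall>y\<in>Y. \<forall>z\<in>Y. \<forall>S T U x' y' z'.
      geodesic_segment Y d x y S \<and> geodesic_segment Y d y z T \<and> geodesic_segment Y d z x U \<and>
      comparison_triangle d x y z x' y' z' \<longrightarrow>
      (let R = (\<lambda>p p'. comparison_point d x S x' y' p p' \<or>
                       comparison_point d y T y' z' p p' \<or>
                       comparison_point d z U z' x' p p')
       in \<forall>p q p' q'. R p p' \<and> R q q' \<longrightarrow> d p q \<le> dist p' q'))"

section \<open>Drift\<close>

text \<open>On a countable group every probability measure is discrete, so it is given by a
  probability mass function.\<close>

definition convolution_pmf :: "('g, 'm) monoid_scheme \<Rightarrow> 'g pmf \<Rightarrow> 'g pmf \<Rightarrow> 'g pmf" where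
  "convolution_pmf G \<mu> \<nu> = map_pmf (\<lambda>(g, h). g \<otimes>\<^bsub>G\<^esub> h) (pair_pmf \<mu> \<nu>)"

primrec convolution_power :: "('g, 'm) monoid_scheme \<Rightarrow> 'g pmf \<Rightarrow> nat \<Rightarrow> 'g pmf" where
  "convolution_power G \<mu> 0 = return_pmf \<one>\<^bsub>G\<^esub>"
| "convolution_power G \<mu> (Suc n) = convolution_pmf G (convolution_power G \<mu> n) \<mu>"

text \<open>That the drift equals l means that the limit defining it exists and has the value l
  for every base point y.\<close>

definition has_drift ::
    "('g, 'm) monoid_scheme \<Rightarrow> 'a set \<Rightarrow> ('a \<Rightarrow> 'a \<Rightarrow> real) \<Rightarrow> ('g \<Rightarrow> 'a \<Rightarrow> 'a) \<Rightarrow> 'g pmf \<Rightarrow> real \<Rightarrow> bool" where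
  "has_drift G Y d \<phi> \<mu> l \<longleftrightarrow>
    (\<forall>y\<in>Y. (\<lambda>n. 1 / real n *
        measure_pmf.expectation (convolution_power G \<mu> n) (\<lambda>g. d y (\<phi> g y)))
      \<longlonglongrightarrow> l)"

end

theory Submission
  imports Defs
begin

text \<open>Write |g| for the displacement d(y, gy) and E(n) for the mean of |g| under the n-th
  convolution power. The sequence E(2^k) / 2^k decreases to a limit L. Suppose L > 0 and put
  n = 2^k. The defect |g| + |h| - |gh| is nonnegative, and for independent g, h distributed
  according to the n-th convolution power its mean is 2 E(n) - E(2n) = o(n). Since |g| is of
  order n with probability bounded below, there are g, h with |g|, |h| at least Ln/2 such that the
  defects of both (g, h) and (h, g) are at most a given small multiple of n. Hence the
  points y, gy, ghy, ghgy, ... form a chain that is nearly straight at every vertex. In a CAT(0)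
  space such a chain is nearly straight in the large (as local geodesics are geodesics), so
  it does not return to y within 2B steps, although (gh)^j = 1 for some j between 1 and B. So L = 0, and
  subadditivity gives E(n) / n -> 0 along all n.\<close>

section \<open>Almost straight chains in CAT(0) spaces\<close>

text \<open>The Bruhat--Tits inequality at an arbitrary point of a geodesic is all that is used of
  the CAT(0) condition.\<close>

locale CN_space = Metric_space Y d for Y :: "'a set" and d :: "'a \<Rightarrow> 'a \<Rightarrow> real" +
  assumes CN: "\<And>x y l. \<lbrakk>x \<in> Y; y \<in> Y; 0 \<le> l; l \<le> 1\<rbrakk> \<Longrightarrow>
    \<exists>z\<in>Y. \<forall>s\<in>Y. (d s z)\<^sup>2 \<le> (1 - l) * (d s x)\<^sup>2 + l * (d s y)\<^sup>2 - l * (1 - l) * (d x y)\<^sup>2"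

section \<open>From comparison triangles to the CN inequality\<close>

lemma comparison_triangle_exists:
  fixes a b c :: real
  assumes "0 \<le> a" "0 \<le> b" "0 \<le> c" "a \<le> b + c" "b \<le> a + c" "c \<le> a + b"
  shows "\<exists>x y z :: real^2. dist x y = a \<and> dist y z = b \<and> dist z x = c"
proof -
  \<comment> \<open>With the vertices at (0,0), (a,0) and (u,v), the law of cosines fixes u. If a =
    0 the quotient is 0, and \<open>au\<close> survives because the triangle inequalities force b =
    c.\<close>
  define u where "u = (a\<^sup>2 + c\<^sup>2 - b\<^sup>2) / (2 * a)"
  define v where "v = sqrt (c\<^sup>2 - u\<^sup>2)"
  have au: "2 * a * u = a\<^sup>2 + c\<^sup>2 - b\<^sup>2"
    using assms by (cases "a = 0") (auto simp: u_def)
  \<comment> \<open>This bounds the cosine at the origin by 1, so that the radicand in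
    \<open>v\<close> is nonnegative.\<close>
  have "\<bar>a\<^sup>2 + c\<^sup>2 - b\<^sup>2\<bar> \<le> 2 * a * c"
  proof -
    have "(a - c)\<^sup>2 \<le> b\<^sup>2" "b\<^sup>2 \<le> (a + c)\<^sup>2"
      using assms by (auto intro!: power_mono abs_le_square_iff[THEN iffD1])
    then show ?thesis by (simp add: power2_eq_square algebra_simps)
  qed
  then have "\<bar>u\<bar> \<le> c"
    using assms by (cases "a = 0") (auto simp: u_def abs_le_iff field_simps)
  then have uv: "u\<^sup>2 + v\<^sup>2 = c\<^sup>2"
    unfolding v_def using assms by (simp add: abs_le_square_iff[symmetric])
  define x y z :: "real^2" where "x = 0" and "y = vector [a, 0]" and "z = vector [u, v]"
  have "dist x y = a"
    using assms by (simp add: x_def y_def norm_vec_def L2_set_def UNIV_2)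
  moreover have "dist z x = c"
    using assms uv by (simp add: x_def z_def norm_vec_def L2_set_def UNIV_2)
  moreover have "dist y z = b"
  proof -
    have "(a - u)\<^sup>2 + v\<^sup>2 = b\<^sup>2"
      using au uv by (simp add: power2_eq_square algebra_simps)
    then show ?thesis
      using assms by (simp add: y_def z_def dist_norm norm_vec_def L2_set_def UNIV_2)
  qed
  ultimately show ?thesis by blast
qed

text \<open>Stewart's theorem: in Euclidean space the CN inequality is an equality, which is the
  source of its right-hand side.\<close>

lemma dist_convex_comb_square:
  fixes x y s :: "'a::real_inner"
  shows "(dist s ((1 - l) *\<^sub>R x + l *\<^sub>R y))\<^sup>2
    = (1 - l) * (dist s x)\<^sup>2 + l * (dist s y)\<^sup>2 - l * (1 - l) * (dist x y)\<^sup>2"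
  unfolding dist_norm power2_norm_eq_inner
  by (simp add: inner_diff_left inner_diff_right inner_add_left inner_add_right algebra_simps inner_commute power2_eq_square)

text \<open>It suffices to compare the distance from a vertex to a point of the opposite side;
  Stewart's identity evaluates its Euclidean counterpart.\<close>

lemma CAT0_imp_CN_space:
  assumes "CAT0_space Y d"
  shows "CN_space Y d"
proof -
  interpret Metric_space Y d using assms by (simp add: CAT0_space_def)
  have geo: "\<exists>S. geodesic_segment Y d x y S" if "x \<in> Y" "y \<in> Y" for x y
    using assms that by (simp add: CAT0_space_def)
  show ?thesis
  proof unfold_locales
    fix x y and l :: real
    assume xy: "x \<in> Y" "y \<in> Y" and l: "0 \<le> l" "l \<le> 1"
    obtain S where S: "geodesic_segment Y d x y S" using geo xy by blast
    then obtain c where c: "c \<in> {0..d x y} \<rightarrow> Y" "c 0 = x" "c (d x y) = y"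
      "\<And>s t. s \<in> {0..d x y} \<Longrightarrow> t \<in> {0..d x y} \<Longrightarrow> d (c s) (c t) = \<bar>s - t\<bar>" "S = c ` {0..d x y}"
      unfolding geodesic_segment_def by blast
    \<comment> \<open>\<open>z\<close> is fixed before \<open>s\<close>, since CN asks for one point
      that serves every \<open>s\<close>.\<close>
    define z where "z = c (l * d x y)"
    have ld: "l * d x y \<in> {0..d x y}"
      using l by (auto intro: mult_left_le_one_le)
    have zY: "z \<in> Y" and zS: "z \<in> S" using c ld by (auto simp: z_def)
    have dxz: "d x z = l * d x y" using c(4)[of 0 "l * d x y"] ld c(2) by (auto simp: z_def)
    have "(d s z)\<^sup>2 \<le> (1 - l) * (d s x)\<^sup>2 + l * (d s y)\<^sup>2 - l * (1 - l) * (d x y)\<^sup>2" if s: "s \<in> Y" for s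
    proof -
      obtain T where T: "geodesic_segment Y d y s T" using geo xy s by blast
      obtain U where U: "geodesic_segment Y d s x U" using geo xy s by blast
      obtain x' y' s' :: "real^2" where t: "dist x' y' = d x y" "dist y' s' = d y s" "dist s' x' = d s x"
        using comparison_triangle_exists[of "d x y" "d y s" "d s x"]
          triangle[of x s y] triangle[of y x s] triangle[of s y x] xy s by (auto simp: commute add.commute)
      define z' where "z' = (1 - l) *\<^sub>R x' + l *\<^sub>R y'"
      have "comparison_point d x S x' y' z z'"
      proof -
        have "x' - z' = l *\<^sub>R (x' - y')" by (simp add: z'_def algebra_simps)
        then have "dist x' z' = l * dist x' y'" using l by (simp add: dist_norm)
        moreover have "z' \<in> closed_segment x' y'" using l by (auto simp: z'_def closed_segment_def)
        ultimately show ?thesis by (simp add: comparison_point_def zS dxz t)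
      qed
      \<comment> \<open>A vertex counts as the point at distance 0 on the side \<open>U\<close> that
        starts there.\<close>
      moreover have "comparison_point d s U s' x' s s'"
        using U s by (force simp: comparison_point_def geodesic_segment_def)
      moreover have "comparison_triangle d x y s x' y' s'" using t by (simp add: comparison_triangle_def)
      ultimately have "d s z \<le> dist s' z'"
        using assms S T U xy s unfolding CAT0_space_def Let_def by blast
      then have "(d s z)\<^sup>2 \<le> (dist s' z')\<^sup>2" by (intro power_mono) auto
      also have "\<dots> = (1 - l) * (d s x)\<^sup>2 + l * (d s y)\<^sup>2 - l * (1 - l) * (d x y)\<^sup>2"
        using t unfolding z'_def dist_convex_comb_square by (simp add: commute dist_commute)
      finally show ?thesis .
    qed
    with zY show "\<exists>z\<in>Y. \<forall>s\<in>Y. (d s z)\<^sup>2 \<le> (1 - l) * (d s x)\<^sup>2 + l * (d s y)\<^sup>2 - l * (1 - l) * (d x y)\<^sup>2"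
      by blast
  qed
qed

section \<open>Propagation of almost straightness along a chain\<close>

context CN_space begin

text \<open>The point q' of the segment from r to p at distance d q r from r is close to q, hence almost
  opposite to s as seen from r; comparison in the triangle p, r, s then bounds d p s from below.\<close>

lemma almost_straight_step:
  assumes Y: "p \<in> Y" "q \<in> Y" "r \<in> Y" "s \<in> Y"
    and h: "0 \<le> \<epsilon>" "\<epsilon> \<le> d p q" "\<epsilon> \<le> d q r" "0 < d q r"
    and 1: "d p q + d q r - d p r \<le> \<epsilon>"
    and 2: "d q r + d r s - d q s \<le> \<eta>"
  shows "d p r + d r s - d p s \<le> 2 * (\<eta> + sqrt (3 * d p r * \<epsilon>)) * d p r / d q r"
proof -
  define e b c t where "e = d p q" and "b = d q r" and "c = d r s" and "t = d p r"
  \<comment> \<open>The weight \<open>l\<close> places the CN point \<open>q'\<close> at distance l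
    t = b from \<open>r\<close>. That b \<le> t follows from assumption \<open>1\<close> and
    \<epsilon> \<le> d p q.\<close>
  define l where "l = b / t"
  have ebct: "0 \<le> e" "0 < b" "0 \<le> c" "b \<le> t" "\<epsilon> \<le> t" "0 < t" "0 \<le> t"
    using h 1 by (auto simp: e_def b_def c_def t_def)
  have lt: "l * t = b" and l: "0 < l" "l \<le> 1" using ebct by (auto simp: l_def)
  obtain q' where q': "q' \<in> Y" and
    C: "\<And>s. s \<in> Y \<Longrightarrow> (d s q')\<^sup>2 \<le> (1 - l) * (d s r)\<^sup>2 + l * (d s p)\<^sup>2 - l * (1 - l) * (d r p)\<^sup>2"
    using CN[of r p l] l Y by auto
  have "(d q q')\<^sup>2 \<le> (1 - l) * b\<^sup>2 + l * e\<^sup>2 - l * (1 - l) * t\<^sup>2"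
    using C[of q] Y by (simp add: e_def b_def t_def commute)
  \<comment> \<open>As e exceeds (1 - l) t by at most \<epsilon>, and b = l t, all terms free of
    \<epsilon> will cancel.\<close>
  also have "\<dots> \<le> (1 - l) * b\<^sup>2 + l * ((1 - l) * t + \<epsilon>)\<^sup>2 - l * (1 - l) * t\<^sup>2"
  proof -
    have "e \<le> (1 - l) * t + \<epsilon>" using 1 lt by (simp add: e_def b_def t_def algebra_simps)
    then have "e\<^sup>2 \<le> ((1 - l) * t + \<epsilon>)\<^sup>2" using ebct by (intro power_mono)
    then show ?thesis using l by (simp add: mult_left_mono)
  qed
  also have "\<dots> = l * (\<epsilon> * (2 * (1 - l) * t + \<epsilon>))"
    unfolding lt[symmetric] by (simp add: power2_eq_square algebra_simps)
  also have "\<dots> \<le> 1 * (\<epsilon> * (2 * t + t))"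
  proof -
    have "2 * (1 - l) * t \<le> 2 * t" using l ebct by simp
    then have "2 * (1 - l) * t + \<epsilon> \<le> 2 * t + t" using ebct by linarith
    then show ?thesis using l h ebct by (intro mult_mono mult_nonneg_nonneg add_nonneg_nonneg) auto
  qed
  finally have qq': "d q q' \<le> sqrt (3 * t * \<epsilon>)"
    by (intro real_le_rsqrt) (simp add: algebra_simps)
  \<comment> \<open>\<open>\<delta>\<close> adds the cost of replacing \<open>q\<close> by
    \<open>q'\<close> to the defect at \<open>r\<close>.\<close>
  define \<delta> where "\<delta> = \<eta> + sqrt (3 * t * \<epsilon>)"
  have "b + c - \<delta> \<le> d s q'"
    using 2 qq' triangle[of q q' s] Y q' by (simp add: \<delta>_def b_def c_def commute)
  moreover have \<delta>: "0 \<le> \<delta>"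
    using triangle[of q r s] 2 Y ebct h by (auto simp: \<delta>_def)
  ultimately have "(b + c)\<^sup>2 - 2 * \<delta> * (b + c) \<le> (d s q')\<^sup>2"
  \<comment> \<open>Squaring requires b + c - \<delta> to be nonnegative; otherwise the left-hand
    side is itself nonpositive.\<close>
  proof (cases "\<delta> \<le> b + c")
    case True
    then have "(b + c - \<delta>)\<^sup>2 \<le> (d s q')\<^sup>2"
      using \<open>b + c - \<delta> \<le> d s q'\<close> by (intro power_mono) auto
    moreover have "(b + c - \<delta>)\<^sup>2 = (b + c)\<^sup>2 - 2 * \<delta> * (b + c) + \<delta>\<^sup>2"
      by (simp add: power2_eq_square algebra_simps)
    ultimately show ?thesis by (smt (verit) zero_le_power2)
  next
    case False
    have "(b + c)\<^sup>2 - 2 * \<delta> * (b + c) = (b + c) * (b + c - 2 * \<delta>)"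
      by (simp add: power2_eq_square algebra_simps)
    also have "\<dots> \<le> 0" using False ebct by (intro mult_nonneg_nonpos) auto
    finally show ?thesis by (smt (verit) zero_le_power2)
  qed
  also have "\<dots> \<le> (1 - l) * c\<^sup>2 + l * (d p s)\<^sup>2 - l * (1 - l) * t\<^sup>2"
    using C[of s] Y by (simp add: c_def t_def commute)
  finally have "l * ((t + c)\<^sup>2 - (d p s)\<^sup>2) \<le> 2 * \<delta> * (b + c)"
    unfolding lt[symmetric] by (simp add: power2_eq_square algebra_simps)
  also have "\<dots> \<le> 2 * \<delta> * (t + c)" using ebct \<delta> by (intro mult_left_mono) auto
  finally have *: "l * ((t + c)\<^sup>2 - (d p s)\<^sup>2) \<le> 2 * \<delta> * (t + c)" .
  \<comment> \<open>The difference of squares factors, and t + c + d p s is at least t + c, so a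
    factor t + c cancels.\<close>
  have "l * (t + c - d p s) * (t + c) \<le> l * ((t + c - d p s) * (t + c + d p s))"
    using l triangle[of p r s] Y ebct
    by (simp add: t_def c_def mult.assoc) (intro mult_left_mono, auto)
  also have "\<dots> = l * ((t + c)\<^sup>2 - (d p s)\<^sup>2)" by (simp add: power2_eq_square algebra_simps)
  finally have "l * (t + c - d p s) * (t + c) \<le> 2 * \<delta> * (t + c)" using * by simp
  then have "l * (t + c - d p s) \<le> 2 * \<delta>" using ebct by (simp add: mult_le_cancel_right)
  then have "b * (t + c - d p s) \<le> 2 * \<delta> * t"
    unfolding lt[symmetric] using ebct by (simp add: mult.assoc mult.left_commute[of l t] mult.commute[of _ t] mult_left_mono)
  then show ?thesis using ebct by (simp add: field_simps \<delta>_def t_def b_def c_def)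
qed

text \<open>The scale N is kept separate so that the admissible defect below does not depend on it.\<close>

definition almost_straight_chain :: "real \<Rightarrow> real \<Rightarrow> real \<Rightarrow> real \<Rightarrow> (nat \<Rightarrow> 'a) \<Rightarrow> bool" where
  "almost_straight_chain a M \<eta> N p \<longleftrightarrow> (\<forall>i. p i \<in> Y \<and>
    a * N \<le> d (p i) (p (Suc i)) \<and> d (p i) (p (Suc i)) \<le> M * N \<and>
    d (p i) (p (Suc i)) + d (p (Suc i)) (p (Suc (Suc i))) - d (p i) (p (Suc (Suc i))) \<le> \<eta> * N)"

lemma almost_straight_chain_mono:
  assumes "almost_straight_chain a M \<eta> N p" "\<eta> \<le> \<eta>'" "0 \<le> N"
  shows "almost_straight_chain a M \<eta>' N p"
  using assms(1) mult_right_mono[OF assms(2,3)] unfolding almost_straight_chain_def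
  by (meson order_trans)

lemma almost_straight_chain_dist_le:
  assumes "almost_straight_chain a M \<eta> N p"
  shows "d (p 0) (p i) \<le> M * real i * N"
proof (induction i)
  case 0
  then show ?case using assms by (simp add: almost_straight_chain_def)
next
  case (Suc i)
  have "d (p 0) (p (Suc i)) \<le> d (p 0) (p i) + d (p i) (p (Suc i))"
    using assms by (intro triangle) (auto simp: almost_straight_chain_def)
  also have "d (p i) (p (Suc i)) \<le> M * N" using assms by (simp add: almost_straight_chain_def)
  finally show ?case using Suc by (simp add: algebra_simps)
qed

text \<open>Induction on m: seen from \<open>p 0\<close>, \<open>almost_straight_step\<close> turns
  a small defect at one vertex into a controlled one at the next, so \<eta> is found backwards
  through finitely many steps. All bounds are homogeneous in N, hence \<eta> does not depend on
  N.\<close>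

lemma almost_straight_chain_defect:
  assumes "0 < a" "0 < M" "0 < \<epsilon>"
  shows "\<exists>\<eta>>0. \<forall>N>0. \<forall>p. almost_straight_chain a M \<eta> N p \<longrightarrow>
    (\<forall>i\<le>m. d (p 0) (p i) + d (p i) (p (Suc i)) - d (p 0) (p (Suc i)) \<le> \<epsilon> * N)"
  using \<open>0 < \<epsilon>\<close>
proof (induction m arbitrary: \<epsilon>)
  case 0
  then show ?case by (intro exI[of _ 1]) (simp add: almost_straight_chain_def)
next
  case (Suc m)
  \<comment> \<open>T N bounds the distance from \<open>p 0\<close> to \<open>p (Suc m)\<close>. The
    limit below says that the loss in the induction step, divided by N, vanishes with the
    defect.\<close>
  define T where "T = M * real (Suc m)"
  have T: "0 < T" using assms by (simp add: T_def)
  have "((\<lambda>x. 2 * (x + sqrt (3 * T * x)) * T / a) \<longlongrightarrow> 2 * (0 + sqrt (3 * T * 0)) * T / a) (at_right 0)"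
    by (intro tendsto_intros) (use assms in auto)
  then have "\<forall>\<^sub>F x in at_right 0. 2 * (x + sqrt (3 * T * x)) * T / a < \<epsilon>"
    using Suc.prems by (intro order_tendstoD(2)[where a = \<epsilon>]) auto
  \<comment> \<open>With e < a / 2 the distances from \<open>p 0\<close> to \<open>p m\<close> and
    from \<open>p m\<close> to \<open>p (Suc m)\<close> stay above e N (the former if m > 0), as
    \<open>almost_straight_step\<close> requires.\<close>
  moreover have "\<forall>\<^sub>F x in at_right 0. x < a / 2"
    using assms by (intro order_tendstoD(2)[OF tendsto_ident_at]) auto
  moreover have "\<forall>\<^sub>F x in at_right (0::real). 0 < x" by (rule eventually_at_right_less)
  ultimately have "\<forall>\<^sub>F x in at_right 0. 2 * (x + sqrt (3 * T * x)) * T / a < \<epsilon> \<and> x < a / 2 \<and> 0 < x"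
    by eventually_elim auto
  then obtain e where e: "2 * (e + sqrt (3 * T * e)) * T / a < \<epsilon>" "e < a / 2" "0 < e"
    using eventually_happens'[OF trivial_limit_at_right_real] by blast
  obtain \<eta>1 where \<eta>1: "0 < \<eta>1" and IH: "\<And>N p i. \<lbrakk>0 < N; almost_straight_chain a M \<eta>1 N p; i \<le> m\<rbrakk> \<Longrightarrow>
      d (p 0) (p i) + d (p i) (p (Suc i)) - d (p 0) (p (Suc i)) \<le> min e \<epsilon> * N"
    using Suc.IH[of "min e \<epsilon>"] Suc.prems e by force
  \<comment> \<open>\<open>\<eta>1\<close> serves the induction hypothesis, \<open>e\<close> the
    local defect at the new vertex, and \<open>\<epsilon>\<close> the case m = 0.\<close>
  define \<eta> where "\<eta> = min \<eta>1 (min e \<epsilon>)"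
  have "d (p 0) (p i) + d (p i) (p (Suc i)) - d (p 0) (p (Suc i)) \<le> \<epsilon> * N"
    if N: "0 < N" and p: "almost_straight_chain a M \<eta> N p" and i: "i \<le> Suc m" for N p i
  proof (cases "i \<le> m")
    case True
    have "almost_straight_chain a M \<eta>1 N p"
      using p N by (rule_tac almost_straight_chain_mono) (auto simp: \<eta>_def)
    then have "d (p 0) (p i) + d (p i) (p (Suc i)) - d (p 0) (p (Suc i)) \<le> min e \<epsilon> * N"
      using IH N True by blast
    also have "\<dots> \<le> \<epsilon> * N" using N by (intro mult_right_mono) auto
    finally show ?thesis .
  next
    case False
    then have i: "i = Suc m" using i by simp
    have pY: "\<And>i. p i \<in> Y" and lower: "\<And>i. a * N \<le> d (p i) (p (Suc i))"
      and defect: "\<And>i. d (p i) (p (Suc i)) + d (p (Suc i)) (p (Suc (Suc i))) - d (p i) (p (Suc (Suc i))) \<le> \<eta> * N"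
      using p by (auto simp: almost_straight_chain_def)
    have eN: "0 < e * N" "e * N \<le> a / 2 * N" and \<eta>: "\<eta> * N \<le> e * N" "\<eta> * N \<le> \<epsilon> * N"
      using N e by (auto simp: \<eta>_def)
    have p1: "almost_straight_chain a M \<eta>1 N p"
      using p N by (rule_tac almost_straight_chain_mono) (auto simp: \<eta>_def)
    have IH': "d (p 0) (p j) + d (p j) (p (Suc j)) - d (p 0) (p (Suc j)) \<le> e * N" if "j \<le> m" for j
    proof -
      have "min e \<epsilon> * N \<le> e * N" using N by (intro mult_right_mono) auto
      then show ?thesis using IH[OF N p1 that] by linarith
    qed
    show ?thesis
    \<comment> \<open>For m = 0 the points \<open>p 0\<close> and \<open>p m\<close> coincide and
      \<open>almost_straight_step\<close> does not apply; the defect is then a local one.\<close>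
    proof (cases m)
      case 0
      then show ?thesis using defect[of 0] \<eta> i by simp
    next
      case (Suc j)
      have "e * N \<le> d (p 0) (p m)"
        using IH'[of j] lower[of j] eN nonneg[of "p 0" "p j"] unfolding Suc by linarith
      moreover have "e * N \<le> d (p m) (p i)" "0 < d (p m) (p i)"
        using lower[of m] eN i by auto
      ultimately have "d (p 0) (p i) + d (p i) (p (Suc i)) - d (p 0) (p (Suc i))
          \<le> 2 * (e * N + sqrt (3 * d (p 0) (p i) * (e * N))) * d (p 0) (p i) / d (p m) (p i)"
        using eN pY IH'[of m] defect[of m] \<eta> i
        by (intro almost_straight_step[of _ "p m"]) auto
      also have "\<dots> \<le> 2 * (e * N + sqrt (3 * (T * N) * (e * N))) * (T * N) / (a * N)"
      proof -
        have t: "d (p 0) (p i) \<le> T * N"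
          using almost_straight_chain_dist_le[OF p, of i] i by (simp add: T_def)
        have "sqrt (3 * d (p 0) (p i) * (e * N)) \<le> sqrt (3 * (T * N) * (e * N))"
          using t eN by (intro real_sqrt_le_mono mult_right_mono) auto
        then show ?thesis
          using t eN e(3) lower[of m] i T N assms
          by (intro frac_le mult_mono add_mono mult_nonneg_nonneg add_nonneg_nonneg real_sqrt_ge_zero) auto
      qed
      also have "sqrt (3 * (T * N) * (e * N)) = sqrt (3 * T * e) * N"
      proof -
        have "3 * (T * N) * (e * N) = 3 * T * e * N\<^sup>2" by (simp add: power2_eq_square)
        then show ?thesis using N by (simp add: real_sqrt_mult)
      qed
      also have "2 * (e * N + sqrt (3 * T * e) * N) * (T * N) / (a * N)
          = 2 * (e + sqrt (3 * T * e)) * T / a * N"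
        using N assms by (simp add: field_simps)
      also have "\<dots> \<le> \<epsilon> * N" using e(1) N by (intro mult_right_mono) auto
      finally show ?thesis .
    qed
  qed
  moreover have "0 < \<eta>" using \<eta>1 e Suc.prems by (simp add: \<eta>_def)
  ultimately show ?case by blast
qed

text \<open>An edge of length at least a N, with defect at most a N / 2 seen from
  \<open>p 0\<close>, ends at distance at least a N / 2 from \<open>p 0\<close>.\<close>

lemma almost_straight_chain_no_return:
  assumes "0 < a" "0 < M"
  shows "\<exists>\<eta>>0. \<forall>N>0. \<forall>p. almost_straight_chain a M \<eta> N p \<longrightarrow> (\<forall>i\<in>{1..m}. p i \<noteq> p 0)"
proof -
  obtain \<eta> where \<eta>: "0 < \<eta>" and H: "\<And>N p i. \<lbrakk>0 < N; almost_straight_chain a M \<eta> N p; i \<le> m\<rbrakk> \<Longrightarrow>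
      d (p 0) (p i) + d (p i) (p (Suc i)) - d (p 0) (p (Suc i)) \<le> a / 2 * N"
    using almost_straight_chain_defect[of a M "a / 2" m] assms by auto
  have "p i \<noteq> p 0" if N: "0 < N" and p: "almost_straight_chain a M \<eta> N p" and i: "i \<in> {1..m}" for N p i
  proof -
    obtain j where j: "i = Suc j" using i by (cases i) auto
    have "a * N \<le> d (p j) (p i)" "p 0 \<in> Y" using p j by (auto simp: almost_straight_chain_def)
    moreover have "0 < a * N" using assms N by simp
    ultimately have "0 < d (p 0) (p i)"
      using H[OF N p, of j] i nonneg[of "p 0" "p j"] unfolding j
      by (simp del: nonneg)
    then show ?thesis using \<open>p 0 \<in> Y\<close> by auto
  qed
  with \<eta> show ?thesis by blast
qed

end

section \<open>Convolution powers and subadditive functions\<close>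

lemma expectation_pair_pmf_mult:
  fixes f :: "'a \<Rightarrow> real" and g :: "'b \<Rightarrow> real"
  assumes "finite (set_pmf p)" "finite (set_pmf q)"
  shows "measure_pmf.expectation (pair_pmf p q) (\<lambda>x. f (fst x) * g (snd x))
    = measure_pmf.expectation p f * measure_pmf.expectation q g"
proof -
  have "measure_pmf.expectation (pair_pmf p q) (\<lambda>x. f (fst x) * g (snd x))
      = (\<Sum>x\<in>set_pmf p \<times> set_pmf q. f (fst x) * g (snd x) * pmf (pair_pmf p q) x)"
    using assms by (intro integral_measure_pmf_real) auto
  also have "\<dots> = (\<Sum>a\<in>set_pmf p. \<Sum>b\<in>set_pmf q. (f a * pmf p a) * (g b * pmf q b))"
    unfolding sum.cartesian_product by (intro sum.cong) (auto simp: pmf_pair)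
  also have "\<dots> = (\<Sum>a\<in>set_pmf p. f a * pmf p a) * (\<Sum>b\<in>set_pmf q. g b * pmf q b)"
    by (simp add: sum_product)
  also have "\<dots> = measure_pmf.expectation p f * measure_pmf.expectation q g"
    using assms by (intro arg_cong2[of _ _ _ _ "(*)"] integral_measure_pmf_real[symmetric]) auto
  finally show ?thesis .
qed

lemma expectation_convolution_pmf:
  fixes f :: "'g \<Rightarrow> real"
  shows "measure_pmf.expectation (convolution_pmf G \<mu> \<nu>) f
    = measure_pmf.expectation (pair_pmf \<mu> \<nu>) (\<lambda>x. f (fst x \<otimes>\<^bsub>G\<^esub> snd x))"
  by (simp add: convolution_pmf_def case_prod_beta)

lemma set_convolution_pmf:
  "set_pmf (convolution_pmf G \<mu> \<nu>) = (\<lambda>(g, h). g \<otimes>\<^bsub>G\<^esub> h) ` (set_pmf \<mu> \<times> set_pmf \<nu>)"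
  by (simp add: convolution_pmf_def)

lemma finite_set_convolution_power:
  "finite (set_pmf \<mu>) \<Longrightarrow> finite (set_pmf (convolution_power G \<mu> n))"
  by (induction n) (auto simp: set_convolution_pmf)

lemma (in monoid) set_convolution_power:
  "set_pmf \<mu> \<subseteq> carrier G \<Longrightarrow> set_pmf (convolution_power G \<mu> n) \<subseteq> carrier G"
  by (induction n) (auto simp: set_convolution_pmf subset_iff)

lemma (in monoid) convolution_pmf_assoc:
  assumes "set_pmf \<mu> \<subseteq> carrier G" "set_pmf \<nu> \<subseteq> carrier G" "set_pmf \<rho> \<subseteq> carrier G"
  shows "convolution_pmf G (convolution_pmf G \<mu> \<nu>) \<rho> = convolution_pmf G \<mu> (convolution_pmf G \<nu> \<rho>)"
proof -
  have "convolution_pmf G (convolution_pmf G \<mu> \<nu>) \<rho>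
      = bind_pmf \<mu> (\<lambda>a. bind_pmf \<nu> (\<lambda>b. bind_pmf \<rho> (\<lambda>c. return_pmf ((a \<otimes> b) \<otimes> c))))"
    by (simp add: convolution_pmf_def pair_pmf_def map_pmf_def bind_assoc_pmf bind_return_pmf)
  also have "\<dots> = bind_pmf \<mu> (\<lambda>a. bind_pmf \<nu> (\<lambda>b. bind_pmf \<rho> (\<lambda>c. return_pmf (a \<otimes> (b \<otimes> c)))))"
    using assms by (intro bind_pmf_cong refl) (auto simp: m_assoc subset_iff)
  also have "\<dots> = convolution_pmf G \<mu> (convolution_pmf G \<nu> \<rho>)"
    by (simp add: convolution_pmf_def pair_pmf_def map_pmf_def bind_assoc_pmf bind_return_pmf)
  finally show ?thesis .
qed

lemma (in monoid) convolution_pmf_one: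
  assumes "set_pmf \<mu> \<subseteq> carrier G"
  shows "convolution_pmf G \<mu> (return_pmf \<one>) = \<mu>"
proof -
  have "convolution_pmf G \<mu> (return_pmf \<one>) = map_pmf (\<lambda>g. g \<otimes> \<one>) \<mu>"
    by (simp add: convolution_pmf_def pair_return_pmf2 map_pmf_comp)
  also have "\<dots> = map_pmf id \<mu>" using assms by (intro map_pmf_cong) auto
  finally show ?thesis by (simp add: map_pmf_id)
qed

lemma (in monoid) convolution_power_add:
  assumes "set_pmf \<mu> \<subseteq> carrier G"
  shows "convolution_power G \<mu> (m + n)
    = convolution_pmf G (convolution_power G \<mu> m) (convolution_power G \<mu> n)"
  using assms
  by (induction n) (simp_all add: convolution_pmf_one convolution_pmf_assoc set_convolution_power)

text \<open>A weighted Markov inequality. The defects of (g, h) and (h, g) have the same mean,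
  whence the factor 2 in \<open>small\<close>; both orders are needed because an alternating word
  contains both gh and hg.\<close>

lemma (in monoid) exists_almost_additive_pair:
  fixes f :: "'a \<Rightarrow> real"
  assumes \<nu>: "finite (set_pmf \<nu>)" "set_pmf \<nu> \<subseteq> carrier G"
    and f: "\<And>g. g \<in> set_pmf \<nu> \<Longrightarrow> f g \<le> K"
    and sub: "\<And>g h. \<lbrakk>g \<in> carrier G; h \<in> carrier G\<rbrakk> \<Longrightarrow> f (g \<otimes> h) \<le> f g + f h"
    and t: "0 \<le> t" "2 * t \<le> measure_pmf.expectation \<nu> f" and \<eta>: "0 \<le> \<eta>"
    and small: "2 * K\<^sup>2 * (2 * measure_pmf.expectation \<nu> f
        - measure_pmf.expectation (convolution_pmf G \<nu> \<nu>) f) < t\<^sup>2 * \<eta>"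
  shows "\<exists>g\<in>set_pmf \<nu>. \<exists>h\<in>set_pmf \<nu>. t \<le> f g \<and> t \<le> f h
    \<and> f g + f h - f (g \<otimes> h) \<le> \<eta> \<and> f h + f g - f (h \<otimes> g) \<le> \<eta>"
proof (rule ccontr)
  assume neg: "\<not> ?thesis"
  let ?E = "measure_pmf.expectation"
  let ?P = "pair_pmf \<nu> \<nu>"
  \<comment> \<open>\<open>u\<close> is a soft indicator of f > t: it vanishes for f \<le> t, is at
    most K where f \<ge> t, and has mean at least t because the mean of f is at least 2 t.\<close>
  define u where "u g = max 0 (f g - t)" for g
  define D where "D x = f (fst x) + f (snd x) - f (fst x \<otimes> snd x)" for x
  have int: "integrable ?P F" for F :: "_ \<Rightarrow> real"
    using \<nu> by (intro integrable_measure_pmf_finite) auto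
  have int1: "integrable \<nu> F" for F :: "_ \<Rightarrow> real"
    using \<nu> by (intro integrable_measure_pmf_finite) auto
  have D: "0 \<le> D x" if "x \<in> carrier G \<times> carrier G" for x
    using sub that by (force simp: D_def)
  \<comment> \<open>If the claim fails, then wherever u (fst x) u (snd x) is nonzero one of the two defects exceeds \<eta>;
    independence of the two factors makes the mean of the left side at least t^2 \<eta>.\<close>
  have bound: "u (fst x) * u (snd x) * \<eta> \<le> K\<^sup>2 * (D x + D (prod.swap x))" if x: "x \<in> set_pmf ?P" for x
  proof (cases "t \<le> f (fst x) \<and> t \<le> f (snd x)")
    case True
    obtain g h where gh: "x = (g, h)" "g \<in> set_pmf \<nu>" "h \<in> set_pmf \<nu>" using x by auto
    have D0: "0 \<le> D (g, h)" "0 \<le> D (h, g)" using D gh \<nu> by auto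
    have "u g * u h \<le> K * K"
      using True gh f[of g] f[of h] t by (intro mult_mono) (auto simp: u_def)
    moreover have "\<eta> \<le> D (g, h) + D (h, g)"
      using neg True gh D0 by (force simp: D_def)
    ultimately have "u g * u h * \<eta> \<le> K * K * (D (g, h) + D (h, g))"
      by (rule mult_mono[OF _ _ zero_le_square \<eta>])
    then show ?thesis using gh by (simp add: power2_eq_square)
  next
    case False
    then have "u (fst x) * u (snd x) * \<eta> = 0" by (auto simp: u_def)
    moreover have "0 \<le> D x" "0 \<le> D (prod.swap x)" using x \<nu> by (auto intro!: D)
    then have "0 \<le> K\<^sup>2 * (D x + D (prod.swap x))" by simp
    ultimately show ?thesis by linarith
  qed
  have ED: "?E ?P D = 2 * ?E \<nu> f - ?E (convolution_pmf G \<nu> \<nu>) f"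
    using int[of "\<lambda>x. f (fst x)"] int[of "\<lambda>x. f (snd x)"] int[of "\<lambda>x. f (fst x \<otimes> snd x)"]
    unfolding D_def expectation_convolution_pmf by simp
  \<comment> \<open>Both factors have the same law, so swapping them preserves the law of the
    pair.\<close>
  have swap: "?E ?P (\<lambda>x. D (prod.swap x)) = ?E ?P D"
    by (subst (2) pair_commute_pmf) (simp add: case_prod_beta prod.swap_def)
  have Eu: "t \<le> ?E \<nu> u"
  proof -
    have "t \<le> ?E \<nu> f - t" using t by simp
    also have "\<dots> = ?E \<nu> (\<lambda>g. f g - t)" using int1 by simp
    also have "\<dots> \<le> ?E \<nu> u" by (intro integral_mono int1) (auto simp: u_def)
    finally show ?thesis .
  qed
  have "t\<^sup>2 * \<eta> \<le> ?E \<nu> u * ?E \<nu> u * \<eta>"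
    using Eu t \<eta> unfolding power2_eq_square by (intro mult_mono) auto
  also have "\<dots> = ?E ?P (\<lambda>x. u (fst x) * u (snd x) * \<eta>)"
    using expectation_pair_pmf_mult[OF \<nu>(1) \<nu>(1), of u u] by simp
  also have "\<dots> \<le> ?E ?P (\<lambda>x. K\<^sup>2 * (D x + D (prod.swap x)))"
    using bound by (intro integral_mono_AE int) (auto simp: AE_measure_pmf_iff)
  also have "\<dots> = K\<^sup>2 * (?E ?P D + ?E ?P (\<lambda>x. D (prod.swap x)))"
    using int[of D] int[of "\<lambda>x. D (prod.swap x)"] by simp
  finally show False using small unfolding swap ED by (simp add: algebra_simps)
qed

text \<open>Fekete's argument with limit 0: divide n by one good N; the quotient part costs at most
  r / 2 per unit, the remainder at most a constant \<open>C\<close>.\<close>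

lemma subadditive_average_tendsto_zero:
  fixes E :: "nat \<Rightarrow> real"
  assumes nonneg: "\<And>n. 0 \<le> E n" and sub: "\<And>m n. E (m + n) \<le> E m + E n"
    and small: "\<And>\<epsilon>. 0 < \<epsilon> \<Longrightarrow> \<exists>N>0. E N \<le> \<epsilon> * real N"
  shows "(\<lambda>n. 1 / real n * E n) \<longlonglongrightarrow> 0"
proof (rule LIMSEQ_I)
  fix r :: real assume r: "0 < r"
  obtain N where N: "0 < N" "E N \<le> r / 2 * real N" using small[of "r / 2"] r by auto
  define C where "C = Max (E ` {..<N})"
  have C: "E k \<le> C" if "k < N" for k using that by (auto simp: C_def)
  have mult: "E (q * N + k) \<le> real q * E N + E k" for q k
  proof (induction q)
    case (Suc q)
    then show ?case using sub[of N "q * N + k"] by (simp add: algebra_simps)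
  qed simp
  have E_le: "E n \<le> r / 2 * real n + C" for n
  proof -
    have "E n \<le> real (n div N) * E N + E (n mod N)" using mult[of "n div N" "n mod N"] by simp
    also have "\<dots> \<le> real (n div N) * (r / 2 * real N) + C"
      using N C by (intro add_mono mult_left_mono) auto
    also have "real (n div N) * (r / 2 * real N) = r / 2 * real (n div N * N)" by simp
    also have "\<dots> \<le> r / 2 * real n"
      using r by (intro mult_left_mono of_nat_mono) (auto simp: div_times_less_eq_dividend)
    finally show ?thesis by simp
  qed
  obtain n0 :: nat where n0: "2 * C / r < real n0" using reals_Archimedean2 by blast
  have "norm (1 / real n * E n - 0) < r" if n: "Suc n0 \<le> n" for n
  proof -
    have "2 * C / r < real n" using n0 n by linarith
    then have "C < r / 2 * real n" using r by (simp add: field_simps)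
    then have "E n < r * real n" using E_le[of n] by linarith
    then show ?thesis using n nonneg[of n] by (simp add: field_simps)
  qed
  then show "\<exists>no. \<forall>n\<ge>no. norm (1 / real n * E n - 0) < r" by blast
qed

section \<open>Isometric actions\<close>

text \<open>Letters are appended on the right, so under an isometric action each edge of the orbit
  chain is a translate of the edge from y to gy or to hy.\<close>

primrec alternating_word :: "('g, 'm) monoid_scheme \<Rightarrow> 'g \<Rightarrow> 'g \<Rightarrow> nat \<Rightarrow> 'g" where
  "alternating_word G g h 0 = \<one>\<^bsub>G\<^esub>"
| "alternating_word G g h (Suc i) = alternating_word G g h i \<otimes>\<^bsub>G\<^esub> (if even i then g else h)"

context monoid begin

lemma alternating_word_closed:
  "\<lbrakk>g \<in> carrier G; h \<in> carrier G\<rbrakk> \<Longrightarrow> alternating_word G g h i \<in> carrier G"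
  by (induction i) auto

lemma alternating_word_even:
  assumes "g \<in> carrier G" "h \<in> carrier G"
  shows "alternating_word G g h (2 * j) = (g \<otimes> h) [^] j"
  using assms by (induction j) (auto simp: m_assoc)

end

section \<open>Displacement and drift of an isometric action\<close>

locale isometric_action = group G + group_action G Y \<phi> + CN_space Y d
  for G (structure) and Y :: "'a set" and \<phi> and d +
  assumes isometry: "\<lbrakk>g \<in> carrier G; x \<in> Y; y \<in> Y\<rbrakk> \<Longrightarrow> d (\<phi> g x) (\<phi> g y) = d x y"
begin

lemma action_closed: "\<lbrakk>g \<in> carrier G; y \<in> Y\<rbrakk> \<Longrightarrow> \<phi> g y \<in> Y"
  using element_image by blast

lemma action_one: "y \<in> Y \<Longrightarrow> \<phi> \<one> y = y"
  using id_eq_one by (metis restrict_apply')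

lemma dist_orbit:
  assumes "g \<in> carrier G" "h \<in> carrier G" "y \<in> Y"
  shows "d (\<phi> g y) (\<phi> (g \<otimes> h) y) = d y (\<phi> h y)"
  using assms by (simp add: composition_rule isometry action_closed)

lemma displacement_mult_le:
  assumes "g \<in> carrier G" "h \<in> carrier G" "y \<in> Y"
  shows "d y (\<phi> (g \<otimes> h) y) \<le> d y (\<phi> g y) + d y (\<phi> h y)"
  using triangle[of y "\<phi> g y" "\<phi> (g \<otimes> h) y"] assms by (simp add: action_closed dist_orbit)

text \<open>Translating back by the i-th word moves two consecutive edges to y, gy, ghy or to y, hy,
  hgy, so the two defect hypotheses cover all vertices.\<close>

lemma alternating_orbit_almost_straight:
  assumes y: "y \<in> Y" and gh: "g \<in> carrier G" "h \<in> carrier G"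
    and len: "a * N \<le> d y (\<phi> g y)" "d y (\<phi> g y) \<le> M * N" "a * N \<le> d y (\<phi> h y)" "d y (\<phi> h y) \<le> M * N"
    and defect: "d y (\<phi> g y) + d y (\<phi> h y) - d y (\<phi> (g \<otimes> h) y) \<le> \<eta> * N"
      "d y (\<phi> h y) + d y (\<phi> g y) - d y (\<phi> (h \<otimes> g) y) \<le> \<eta> * N"
  shows "almost_straight_chain a M \<eta> N (\<lambda>i. \<phi> (alternating_word G g h i) y)"
  unfolding almost_straight_chain_def
proof (intro allI)
  fix i
  let ?w = "alternating_word G g h"
  define s where "s i = (if even i then g else h)" for i :: nat
  have s: "\<And>i. s i \<in> carrier G" and w: "\<And>i. ?w i \<in> carrier G"
    using gh by (auto simp: s_def alternating_word_closed)
  have step: "?w (Suc i) = ?w i \<otimes> s i" for i by (simp add: s_def)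
  have "d (\<phi> (?w i) y) (\<phi> (?w (Suc i)) y) = d y (\<phi> (s i) y)" for i
    unfolding step using s w y by (simp add: dist_orbit)
  moreover have "d (\<phi> (?w i) y) (\<phi> (?w (Suc (Suc i))) y) = d y (\<phi> (s i \<otimes> s (Suc i)) y)"
    unfolding step using s w y by (simp add: dist_orbit m_assoc)
  ultimately show "\<phi> (?w i) y \<in> Y \<and> a * N \<le> d (\<phi> (?w i) y) (\<phi> (?w (Suc i)) y)
      \<and> d (\<phi> (?w i) y) (\<phi> (?w (Suc i)) y) \<le> M * N
      \<and> d (\<phi> (?w i) y) (\<phi> (?w (Suc i)) y) + d (\<phi> (?w (Suc i)) y) (\<phi> (?w (Suc (Suc i))) y)
          - d (\<phi> (?w i) y) (\<phi> (?w (Suc (Suc i))) y) \<le> \<eta> * N"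
    using len defect action_closed[OF w y] by (simp add: s_def del: alternating_word.simps)
qed

text \<open>\<open>ord\<close> is 0 on elements of infinite order, so positivity encodes finite
  order.\<close>

lemma bounded_order_drift_zero:
  assumes ord: "\<And>g. g \<in> carrier G \<Longrightarrow> 0 < ord g \<and> ord g \<le> B"
    and \<mu>: "set_pmf \<mu> \<subseteq> carrier G" "finite (set_pmf \<mu>)" and y: "y \<in> Y"
  shows "(\<lambda>n. 1 / real n * measure_pmf.expectation (convolution_power G \<mu> n) (\<lambda>g. d y (\<phi> g y))) \<longlonglongrightarrow> 0"
proof -
  let ?P = "convolution_power G \<mu>"
  define f where "f g = d y (\<phi> g y)" for g
  define E where "E n = measure_pmf.expectation (?P n) f" for n
  have PG: "set_pmf (?P n) \<subseteq> carrier G" and Pfin: "finite (set_pmf (?P n))" for n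
    using \<mu> by (simp_all add: set_convolution_power finite_set_convolution_power)
  have int: "integrable (pair_pmf (?P m) (?P n)) F" for m n and F :: "_ \<Rightarrow> real"
    using Pfin by (auto intro!: integrable_measure_pmf_finite)
  have f_mult: "f (g \<otimes> h) \<le> f g + f h" if "g \<in> carrier G" "h \<in> carrier G" for g h
    using that y by (simp add: f_def displacement_mult_le)
  have E_nonneg: "0 \<le> E n" for n by (simp add: E_def f_def)
  have E_sub: "E (m + n) \<le> E m + E n" for m n
  proof -
    have "E (m + n) \<le> measure_pmf.expectation (pair_pmf (?P m) (?P n)) (\<lambda>x. f (fst x) + f (snd x))"
      unfolding E_def convolution_power_add[OF \<mu>(1)] expectation_convolution_pmf
      using PG[of m] PG[of n] by (intro integral_mono_AE int) (auto simp: AE_measure_pmf_iff intro!: f_mult)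
    also have "\<dots> = E m + E n"
      using int[of m n "\<lambda>x. f (fst x)"] int[of m n "\<lambda>x. f (snd x)"] by (simp add: E_def)
    finally show ?thesis .
  qed
  obtain M where M: "0 < M" "\<And>g. g \<in> set_pmf \<mu> \<Longrightarrow> f g \<le> M"
  proof
    show "0 < Max (insert 1 (f ` set_pmf \<mu>))" using \<mu> by (simp add: Max_gr_iff)
    show "f g \<le> Max (insert 1 (f ` set_pmf \<mu>))" if "g \<in> set_pmf \<mu>" for g using \<mu> that by simp
  qed
  have f_le: "f g \<le> M * real n" if "g \<in> set_pmf (?P n)" for g n
    using that
  proof (induction n arbitrary: g)
    case 0
    then show ?case using y by (simp add: f_def action_one)
  next
    case (Suc n)
    then obtain g' s where g: "g = g' \<otimes> s" "g' \<in> set_pmf (?P n)" "s \<in> set_pmf \<mu>"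
      by (auto simp: set_convolution_pmf)
    then have "f g \<le> f g' + f s" using PG \<mu> by (auto intro!: f_mult)
    then show ?case using Suc.IH[OF g(2)] M(2)[OF g(3)] by (simp add: algebra_simps)
  qed
  define a where "a k = E (2 ^ k) / 2 ^ k" for k :: nat
  have E_a: "E (2 ^ k) = a k * 2 ^ k" for k by (simp add: a_def)
  have a_nonneg: "0 \<le> a k" for k using E_nonneg by (simp add: a_def)
  have "decseq a"
  proof (rule decseq_SucI)
    fix k
    have "E (2 ^ Suc k) \<le> 2 * E (2 ^ k)" using E_sub[of "2 ^ k" "2 ^ k"] by (simp flip: mult_2)
    then show "a (Suc k) \<le> a k" by (simp add: a_def field_simps)
  qed
  then obtain L where L: "a \<longlonglongrightarrow> L" "\<And>k. L \<le> a k"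
    using decseq_convergent[of a 0] a_nonneg by blast
  have "L \<le> 0"
  proof (rule ccontr)
    assume "\<not> L \<le> 0"
    then have Lpos: "0 < L" by simp
    \<comment> \<open>The word of length 2 j is the j-th power of gh, and j is at most B; hence 2 B.
      The tolerance \<eta> is fixed before the scale n.\<close>
    obtain \<eta> where \<eta>: "0 < \<eta>" and no_return: "\<And>N p i.
        \<lbrakk>0 < N; almost_straight_chain (L / 2) M \<eta> N p; i \<in> {1..2 * B}\<rbrakk> \<Longrightarrow> p i \<noteq> p 0"
      using almost_straight_chain_no_return[of "L / 2" M "2 * B"] Lpos M by auto
    \<comment> \<open>\<open>\<delta>\<close> solves 2 (M n)^2 (2 n \<delta>) = (L n / 2)^2 \<eta>
      n, the threshold in \<open>exists_almost_additive_pair\<close> for K = M n, t = L n / 2 and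
      tolerance \<eta> n.\<close>
    define \<delta> where "\<delta> = L\<^sup>2 * \<eta> / (16 * M\<^sup>2)"
    have "(\<lambda>k. a k - a (Suc k)) \<longlonglongrightarrow> L - L"
      by (intro tendsto_diff L LIMSEQ_Suc)
    moreover have "0 < \<delta>" using Lpos \<eta> M by (simp add: \<delta>_def)
    ultimately have "\<forall>\<^sub>F k in sequentially. a k - a (Suc k) < \<delta>"
      by (intro order_tendstoD(2)[where a = \<delta>]) auto
    then obtain k where k: "a k - a (Suc k) < \<delta>"
      by (auto simp: eventually_sequentially)
    define n where "n = (2::nat) ^ k"
    have n: "0 < real n" by (simp add: n_def)
    have "\<exists>g\<in>set_pmf (?P n). \<exists>h\<in>set_pmf (?P n). L / 2 * real n \<le> f g \<and> L / 2 * real n \<le> f h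
      \<and> f g + f h - f (g \<otimes> h) \<le> \<eta> * real n \<and> f h + f g - f (h \<otimes> g) \<le> \<eta> * real n"
    proof (rule exists_almost_additive_pair[OF Pfin PG f_le f_mult])
      show "2 * (L / 2 * real n) \<le> measure_pmf.expectation (?P n) f"
        using L(2)[of k] E_a[of k] by (simp add: n_def E_def mult_right_mono)
      \<comment> \<open>The mean defect is the drop between consecutive dyadic averages, scaled by 2
        n.\<close>
      have "2 * E n - E (n + n) = 2 * real n * (a k - a (Suc k))"
      proof -
        have "n + n = 2 ^ Suc k" by (simp add: n_def)
        then have "E (n + n) = a (Suc k) * (2 * real n)" using E_a[of "Suc k"] by (simp only:) (simp add: n_def)
        moreover have "E n = a k * real n" using E_a[of k] by (simp add: n_def)
        ultimately show ?thesis by (simp add: algebra_simps)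
      qed
      also have "\<dots> < 2 * real n * \<delta>" using k n by simp
      finally have "2 * (M * real n)\<^sup>2 * (2 * E n - E (n + n)) < 2 * (M * real n)\<^sup>2 * (2 * real n * \<delta>)"
        using M n by (intro mult_strict_left_mono) auto
      also have "\<dots> = (L / 2 * real n)\<^sup>2 * (\<eta> * real n)"
        using M by (simp add: \<delta>_def field_simps power2_eq_square)
      finally show "2 * (M * real n)\<^sup>2 * (2 * measure_pmf.expectation (?P n) f
          - measure_pmf.expectation (convolution_pmf G (?P n) (?P n)) f)
          < (L / 2 * real n)\<^sup>2 * (\<eta> * real n)"
        by (simp add: E_def convolution_power_add[OF \<mu>(1)])
    qed (use Lpos \<eta> in auto)
    then obtain g h where gh: "g \<in> set_pmf (?P n)" "h \<in> set_pmf (?P n)"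
      and len: "L / 2 * real n \<le> f g" "L / 2 * real n \<le> f h"
      and defect: "f g + f h - f (g \<otimes> h) \<le> \<eta> * real n" "f h + f g - f (h \<otimes> g) \<le> \<eta> * real n"
      by blast
    have G: "g \<in> carrier G" "h \<in> carrier G" using gh PG by auto
    define j where "j = ord (g \<otimes> h)"
    have j: "1 \<le> j" "j \<le> B" using ord[of "g \<otimes> h"] G by (auto simp: j_def)
    have "\<phi> (alternating_word G g h (2 * j)) y \<noteq> \<phi> (alternating_word G g h 0) y"
      using len defect f_le[OF gh(1)] f_le[OF gh(2)] y G j n unfolding f_def
      by (intro no_return[of "real n"] alternating_orbit_almost_straight) auto
    moreover have "alternating_word G g h (2 * j) = \<one>"
      using G by (simp add: alternating_word_even j_def)
    ultimately show False by simp
  qed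
  \<comment> \<open>One good scale for each \<epsilon> is all that the subadditive argument asks, so
    dyadic ones suffice.\<close>
  have "\<exists>N>0. E N \<le> \<epsilon> * real N" if "0 < \<epsilon>" for \<epsilon>
  proof -
    have "\<forall>\<^sub>F k in sequentially. a k < \<epsilon>"
      using \<open>L \<le> 0\<close> that by (intro order_tendstoD(2)[OF L(1)]) auto
    then obtain k where "a k < \<epsilon>" by (auto simp: eventually_sequentially)
    then have "E (2 ^ k) \<le> \<epsilon> * real (2 ^ k)" by (simp add: E_a)
    then show ?thesis by (intro exI[of _ "2 ^ k"]) simp
  qed
  then have "(\<lambda>n. 1 / real n * E n) \<longlonglongrightarrow> 0"
    using E_nonneg E_sub by (intro subadditive_average_tendsto_zero)
  then show ?thesis unfolding E_def f_def[abs_def] .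
qed

end

theorem lemma3p2:
  fixes G :: "('g, 'm) monoid_scheme"
    and Y :: "'a set"
    and d :: "'a \<Rightarrow> 'a \<Rightarrow> real"
    and \<phi> :: "'g \<Rightarrow> 'a \<Rightarrow> 'a"
    and B :: nat
    and \<mu> :: "'g pmf"
  assumes "group G" and "countable (carrier G)"
    and "CAT0_space Y d" and "Metric_space.mcomplete Y d"
    and "group_action G Y \<phi>"
    and "\<And>g x y. \<lbrakk>g \<in> carrier G; x \<in> Y; y \<in> Y\<rbrakk> \<Longrightarrow> d (\<phi> g x) (\<phi> g y) = d x y"
    and "\<And>g. g \<in> carrier G \<Longrightarrow> 0 < group.ord G g \<and> group.ord G g \<le> B"
    and "set_pmf \<mu> \<subseteq> carrier G" and "finite (set_pmf \<mu>)"
  shows "has_drift G Y d \<phi> \<mu> 0"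
proof -
  interpret isometric_action G Y \<phi> d
    using assms by (intro isometric_action.intro isometric_action_axioms.intro CAT0_imp_CN_space)
  show ?thesis
    unfolding has_drift_def using bounded_order_drift_zero assms by blast
qed

end
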